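(* For any diagonal section $\delta$ the following are equivalent: (i) $\overline{C}_\delta=A_\delta$; (ii) $y-x\ge\max\{\widehat{\delta}(x),\widehat{\delta}(y)\}$ whenever $x,y\in[0,1]$ are such that $x<y$, the derivatives $\widehat{\delta}'(x)$ and $\widehat{\delta}'(y)$ exist, and $\widehat{\delta}'(x)<0<\widehat{\delta}'(y)$.
   Context: $\mathbb{I}=[0,1]$. A (bivariate) copula is a function $C\colon\mathbb{I}^2\to\mathbb{I}$ with $C(x,0)=C(0,y)=0$, $C(x,1)=x$, $C(1,y)=y$ for all $x,y$, and $C(b,d)+C(a,c)-C(b,c)-C(a,d)\ge 0$ for all $a\le b$, $c\le d$. A quasi-copula is a function $Q\colon\mathbb{I}^2\to\mathbb{I}$ with $Q(x,0)=Q(0,y)=0$, $Q(x,1)=x$, $Q(1,y)=y$, increasing in each variable and 1-Lipschitz in each variable. A diagonal section is a function $\delta\colon\mathbb{I}\to\mathbb{I}$ with $\delta(x)\le x$ for all $x$, $0\le\delta(y)-\delta(x)\le 2(y-x)$ whenever $x\le y$, and $\delta(1)=1$. Write $\widehat{\delta}(x)=x-\delta(x)$. Define $\overline{C}_\delta(x,y)=\sup\{C(x,y): C \text{ a copula with } C(t,t)=\delta(t)\ \forall t\}$ and $A_\delta(x,y)=\sup\{Q(x,y): Q \text{ a quasi-copula with } Q(t,t)=\delta(t)\ \forall t\}$. *)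

theory Defs
  imports "HOL-Analysis.Analysis"
begin

definition copula :: "(real \<Rightarrow> real \<Rightarrow> real) \<Rightarrow> bool" where
  "copula C \<longleftrightarrow>
     (\<forall>x\<in>{0..1}. \<forall>y\<in>{0..1}. C x y \<in> {0..1}) \<and>
     (\<forall>x\<in>{0..1}. C x 0 = 0 \<and> C 0 x = 0 \<and> C x 1 = x \<and> C 1 x = x) \<and>
     (\<forall>a\<in>{0..1}. \<forall>b\<in>{0..1}. \<forall>c\<in>{0..1}. \<forall>d\<in>{0..1}.
        a \<le> b \<longrightarrow> c \<le> d \<longrightarrow> C b d + C a c - C b c - C a d \<ge> 0)"

definition quasi_copula :: "(real \<Rightarrow> real \<Rightarrow> real) \<Rightarrow> bool" where
  "quasi_copula Q \<longleftrightarrow>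
     (\<forall>x\<in>{0..1}. \<forall>y\<in>{0..1}. Q x y \<in> {0..1}) \<and>
     (\<forall>x\<in>{0..1}. Q x 0 = 0 \<and> Q 0 x = 0 \<and> Q x 1 = x \<and> Q 1 x = x) \<and>
     (\<forall>x1\<in>{0..1}. \<forall>x2\<in>{0..1}. \<forall>y\<in>{0..1}. x1 \<le> x2 \<longrightarrow>
        Q x1 y \<le> Q x2 y \<and> Q y x1 \<le> Q y x2) \<and>
     (\<forall>x1\<in>{0..1}. \<forall>x2\<in>{0..1}. \<forall>y\<in>{0..1}.
        \<bar>Q x1 y - Q x2 y\<bar> \<le> \<bar>x1 - x2\<bar> \<and> \<bar>Q y x1 - Q y x2\<bar> \<le> \<bar>x1 - x2\<bar>)"

definition diagonal_section :: "(real \<Rightarrow> real) \<Rightarrow> bool" where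
  "diagonal_section \<delta> \<longleftrightarrow>
     (\<forall>x\<in>{0..1}. \<delta> x \<in> {0..1} \<and> \<delta> x \<le> x) \<and>
     (\<forall>x\<in>{0..1}. \<forall>y\<in>{0..1}. x \<le> y \<longrightarrow> 0 \<le> \<delta> y - \<delta> x \<and> \<delta> y - \<delta> x \<le> 2 * (y - x)) \<and>
     \<delta> 1 = 1"

definition delta_hat :: "(real \<Rightarrow> real) \<Rightarrow> real \<Rightarrow> real" where
  "delta_hat \<delta> x = x - \<delta> x"

definition has_diagonal :: "(real \<Rightarrow> real \<Rightarrow> real) \<Rightarrow> (real \<Rightarrow> real) \<Rightarrow> bool" where
  "has_diagonal C \<delta> \<longleftrightarrow> (\<forall>t\<in>{0..1}. C t t = \<delta> t)"

definition C_upper :: "(real \<Rightarrow> real) \<Rightarrow> real \<Rightarrow> real \<Rightarrow> real" where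
  "C_upper \<delta> x y = Sup {C x y | C. copula C \<and> has_diagonal C \<delta>}"

definition A_delta :: "(real \<Rightarrow> real) \<Rightarrow> real \<Rightarrow> real \<Rightarrow> real" where
  "A_delta \<delta> x y = Sup {Q x y | Q. quasi_copula Q \<and> has_diagonal Q \<delta>}"

end

theory Submission
  imports Defs
begin

text \<open>
  Write \<open>f = delta_hat \<delta>\<close> as \<open>P - N\<close> with its positive and negative variations \<open>P\<close>, \<open>N\<close>; both are 1-Lipschitz.
  For every copula with diagonal \<open>\<delta>\<close> and \<open>x \<le> y\<close> one has \<open>C x y \<le> min x (y - (P y - N x))\<close>, and
  \<open>K s t = min (s - N s) (t - P t) + min (N s) (P t)\<close> is a copula with diagonal \<open>\<delta>\<close> attaining this bound: it
  transports the mass above the diagonal, and likewise the mass below it, first in, first out.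
  For quasi-copulas the corresponding bound is \<open>min x (y - max f)\<close> with the maximum over \<open>[x, y]\<close>, and
  \<open>P y - N x \<ge> max f\<close> with equality iff \<open>f\<close> increases and then decreases on \<open>[x, y]\<close>. So the two bounds differ only
  if \<open>f\<close> has a negative derivative at some \<open>s\<close> and a positive one at a later \<open>t\<close>, and the second condition is what
  makes both minima equal to \<open>x\<close> in that case. That monotonicity can be read off from the points of differentiability
  rests on the Lebesgue differentiation theorem for Lipschitz functions.
\<close>

subsection \<open>Lipschitz functions are differentiable almost everywhere\<close>

lemma emeasure_interval_measure_Ioo:
  assumes "a \<le> b" "mono F" "continuous_on UNIV F"
  shows "emeasure (interval_measure F) {a<..<b} = ennreal (F b - F a)"
proof -
  have cont: "continuous (at_right x) F" for x
    using assms(3) by (simp add: continuous_on_eq_continuous_within continuous_at_imp_continuous_at_within)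
  have "emeasure (interval_measure F) {b..b} = 0"
    using emeasure_interval_measure_Icc[of b b F] assms(2,3) by (simp add: mono_def)
  then have null: "{b} \<in> null_sets (interval_measure F)"
    by (intro null_setsI) auto
  have "{a<..<b} = {a<..b} - {b}"
    by auto
  then have "emeasure (interval_measure F) {a<..<b} = emeasure (interval_measure F) {a<..b}"
    using emeasure_Diff_null_set[OF null] by simp
  also have "\<dots> = ennreal (F b - F a)"
    using assms(1,2) cont by (intro emeasure_interval_measure_Ioc) (auto simp: mono_def)
  finally show ?thesis .
qed

text \<open>As \<open>F + G\<close> is the identity, the Stieltjes measures of \<open>F\<close> and
  \<open>G\<close> add up to Lebesgue measure, so each is dominated by it.\<close>

lemma absolutely_continuous_interval_measure:
  assumes F: "mono F" "continuous_on UNIV F"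
    and G: "mono G" "continuous_on UNIV G"
    and sum: "\<And>t::real. F t + G t = t"
  shows "absolutely_continuous lborel (interval_measure F)"
proof -
  define \<mu> where "\<mu> A = emeasure (interval_measure F) A + emeasure (interval_measure G) A" for A
  define K where "K = measure_of UNIV (sets borel) \<mu>"
  have K: "emeasure K A = \<mu> A" if "A \<in> sets borel" for A
    unfolding K_def
  proof (rule emeasure_measure_of_sigma)
    show "sigma_algebra UNIV (sets (borel :: real measure))"
      using sets.sigma_algebra_axioms[of "borel :: real measure"] by simp
    show "positive (sets borel) \<mu>"
      by (simp add: positive_def \<mu>_def)
    show "countably_additive (sets borel) \<mu>"
    proof (rule countably_additiveI)
      fix A :: "nat \<Rightarrow> real set"
      assume A: "range A \<subseteq> sets borel" "disjoint_family A" "\<Union> (range A) \<in> sets borel"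
      have "(\<Sum>i. \<mu> (A i)) = (\<Sum>i. emeasure (interval_measure F) (A i)) + (\<Sum>i. emeasure (interval_measure G) (A i))"
        unfolding \<mu>_def by (rule suminf_add[symmetric]) auto
      then show "(\<Sum>i. \<mu> (A i)) = \<mu> (\<Union> (range A))"
        using A by (simp add: suminf_emeasure \<mu>_def)
    qed
  qed fact
  \<comment> \<open>Boxes determine Lebesgue measure, and on them the increments of \<open>F\<close>
    and \<open>G\<close> sum to the length.\<close>
  have "lborel = K"
  proof (rule lborel_eqI)
    show "sets K = sets borel"
      using sets.sigma_sets_eq[of "borel :: real measure"] by (simp add: K_def)
    fix l u :: real assume "\<And>b. b \<in> Basis \<Longrightarrow> l \<bullet> b \<le> u \<bullet> b"
    then have lu: "l \<le> u" by simp
    then have "F l \<le> F u" "G l \<le> G u"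
      using F(1) G(1) by (auto simp: mono_def)
    moreover have "F u - F l + (G u - G l) = u - l"
      using sum[of u] sum[of l] by simp
    ultimately show "emeasure K (box l u) = ennreal (\<Prod>b\<in>Basis. (u - l) \<bullet> b)"
      using lu F G
      by (simp add: K \<mu>_def emeasure_interval_measure_Ioo flip: ennreal_plus)
  qed
  show ?thesis
    unfolding absolutely_continuous_def
  proof
    fix A assume "A \<in> null_sets (lborel :: real measure)"
    then have A: "A \<in> sets borel" "emeasure lborel A = 0"
      by auto
    then have "\<mu> A = 0"
      using K[of A] \<open>lborel = K\<close> by simp
    then show "A \<in> null_sets (interval_measure F)"
      using A by (intro null_setsI) (auto simp: \<mu>_def)
  qed
qed

text \<open>Both \<open>t + f t / L\<close> and \<open>t - f t / L\<close> increase with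
  \<open>t\<close>, and their halves sum to \<open>t\<close>. Radon-Nikodym gives the first a
  density, and \<open>f\<close> is an affine combination of it and the identity.\<close>

lemma lipschitz_has_integral_density:
  fixes f :: "real \<Rightarrow> real"
  assumes "L-lipschitz_on UNIV f" "0 < L"
  obtains \<phi> where "\<And>a b. a \<le> b \<Longrightarrow> (\<phi> has_integral f b - f a) {a..b}"
proof -
  define F where "F t = (t + f t / L) / 2" for t
  define G where "G t = (t - f t / L) / 2" for t
  have bound: "\<bar>f t / L - f s / L\<bar> \<le> t - s" if "s \<le> t" for s t
    using lipschitz_onD[OF assms(1), of t s] that \<open>0 < L\<close>
    by (simp add: dist_real_def field_simps flip: diff_divide_distrib)
  have cont: "continuous_on UNIV f"
    using assms(1) by (rule lipschitz_on_continuous_on)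
  have mono: "mono F" "mono G"
  proof -
    show "mono F"
    proof
      fix s t :: real assume "s \<le> t"
      from bound[OF this] show "F s \<le> F t"
        unfolding F_def by argo
    qed
    show "mono G"
    proof
      fix s t :: real assume "s \<le> t"
      from bound[OF this] show "G s \<le> G t"
        unfolding G_def by argo
    qed
  qed
  have contF: "continuous_on UNIV F" and contG: "continuous_on UNIV G"
    unfolding F_def G_def using \<open>0 < L\<close> by (auto intro!: continuous_intros cont)
  let ?M = "interval_measure F"
  have ac: "absolutely_continuous lborel ?M"
    by (rule absolutely_continuous_interval_measure[OF mono(1) contF mono(2) contG])
      (simp add: F_def G_def field_simps)
  have sets: "sets ?M = sets lborel"
    by simp
  have "sigma_finite_measure ?M"
    using mono(1) contF
    by (intro sigma_finite_interval_measure)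
      (auto simp: mono_def continuous_on_eq_continuous_within continuous_at_imp_continuous_at_within)
  then have fin: "AE x in lborel. RN_deriv lborel ?M x \<noteq> \<infinity>"
    using sigma_finite_measure.RN_deriv_finite[OF sigma_finite_lborel] ac sets by blast
  \<comment> \<open>The density is finite almost everywhere, so passing to real values leaves its
    integrals unchanged.\<close>
  define h where "h x = enn2real (RN_deriv lborel ?M x)" for x
  have h_meas [measurable]: "h \<in> borel_measurable borel"
    using borel_measurable_RN_deriv[of lborel ?M] unfolding h_def by simp
  have h: "(h has_integral F b - F a) {a..b}" if "a \<le> b" for a b
  proof -
    have "(\<integral>\<^sup>+x. ennreal (h x * indicator {a..b} x) \<partial>lborel) = (\<integral>\<^sup>+x. RN_deriv lborel ?M x * indicator {a..b} x \<partial>lborel)"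
      using fin by (intro nn_integral_cong_AE) (auto simp: h_def indicator_def less_top elim!: eventually_mono)
    also have "\<dots> = emeasure (density lborel (RN_deriv lborel ?M)) {a..b}"
      by (simp add: emeasure_density)
    also have "\<dots> = emeasure ?M {a..b}"
      using sigma_finite_measure.density_RN_deriv[OF sigma_finite_lborel ac sets] by simp
    also have "\<dots> = ennreal (F b - F a)"
      using mono(1) contF that by (intro emeasure_interval_measure_Icc) (auto simp: mono_def)
    finally have "((\<lambda>x. h x * indicator {a..b} x) has_integral F b - F a) UNIV"
      using mono(1) that
      by (intro nn_integral_has_integral) (auto simp: h_def mono_def)
    moreover have "(\<lambda>x. h x * indicator {a..b} x) = (\<lambda>x. if x \<in> {a..b} then h x else 0)"
      by (auto simp: indicator_def)
    ultimately show ?thesis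
      by (simp only: has_integral_restrict_UNIV)
  qed
  show ?thesis
  proof
    fix a b :: real assume "a \<le> b"
    \<comment> \<open>This density comes from solving the definition of \<open>F\<close> for
      \<open>f\<close>: \<open>f t = L * (2 * F t - t)\<close>.\<close>
    have "((\<lambda>x. 2 * L * h x - L) has_integral 2 * L * (F b - F a) - (b - a) *\<^sub>R L) {a..b}"
      using \<open>a \<le> b\<close> h has_integral_const_real[of L a b]
      by (intro has_integral_diff has_integral_mult_right) auto
    moreover have "2 * L * (F b - F a) - (b - a) *\<^sub>R L = f b - f a"
      using \<open>0 < L\<close> by (simp add: F_def field_simps)
    ultimately show "((\<lambda>x. 2 * L * h x - L) has_integral f b - f a) {a..b}"
      by simp
  qed
qed

text \<open>Lebesgue differentiation from the right comes from the library; the left side follows by reflection.\<close>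

lemma indefinite_integral_has_derivative_ae:
  fixes f \<phi> :: "real \<Rightarrow> real"
  assumes int: "\<And>a b. a \<le> b \<Longrightarrow> (\<phi> has_integral f b - f a) {a..b}"
  obtains S where "negligible S" "\<And>x. x \<notin> S \<Longrightarrow> (f has_real_derivative \<phi> x) (at x)"
proof -
  \<comment> \<open>The reflected density has the primitive \<open>- f (- x)\<close>, whose right
    difference quotients at \<open>- x\<close> are the left ones of \<open>f\<close> at
    \<open>x\<close>.\<close>
  have refl: "((\<lambda>x. \<phi> (- x)) has_integral f (-a) - f (-b)) {a..b}" if "a \<le> b" for a b
    using int[of "-b" "-a"] that has_integral_reflect_real[of \<phi> "f (-a) - f (-b)" "-a" "-b"] by simp
  have "\<phi> integrable_on cbox a b" "(\<lambda>x. \<phi> (- x)) integrable_on cbox a b" for a b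
    using int[of a b] refl[of a b] by (cases "a \<le> b"; auto simp: integrable_on_def)+
  then obtain S1 S2 where neg: "negligible S1" "negligible S2"
    and S1: "\<And>x e. \<lbrakk>x \<notin> S1; 0 < e\<rbrakk> \<Longrightarrow>
      \<exists>d>0. \<forall>h. 0 < h \<and> h < d \<longrightarrow> norm (integral (cbox x (x + h *\<^sub>R One)) \<phi> /\<^sub>R h ^ DIM(real) - \<phi> x) < e"
    and S2: "\<And>x e. \<lbrakk>x \<notin> S2; 0 < e\<rbrakk> \<Longrightarrow>
      \<exists>d>0. \<forall>h. 0 < h \<and> h < d \<longrightarrow> norm (integral (cbox x (x + h *\<^sub>R One)) (\<lambda>x. \<phi> (- x)) /\<^sub>R h ^ DIM(real) - \<phi> (- x)) < e"
    by (metis integrable_ccontinuous_explicit)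
  show ?thesis
  proof
    show "negligible (S1 \<union> uminus ` S2)"
      using neg by (auto intro!: negligible_differentiable_image_negligible derivative_intros)
    fix x assume x: "x \<notin> S1 \<union> uminus ` S2"
    then have "x \<notin> S1" "-x \<notin> S2"
      by (auto simp: image_iff)
    have "(\<lambda>h. (f (x + h) - f x) / h) \<midarrow>0\<rightarrow> \<phi> x"
    proof (rule LIM_I)
      fix e :: real assume "0 < e"
      obtain d1 where d1: "d1 > 0"
        "\<And>h. 0 < h \<Longrightarrow> h < d1 \<Longrightarrow> \<bar>(f (x + h) - f x) / h - \<phi> x\<bar> < e"
      proof -
        obtain d where d: "d > 0" "\<And>h. 0 < h \<Longrightarrow> h < d \<Longrightarrow> \<bar>integral {x..x + h} \<phi> / h - \<phi> x\<bar> < e"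
          using S1[OF \<open>x \<notin> S1\<close> \<open>0 < e\<close>] by (auto simp: divide_inverse_commute)
        have "integral {x..x + h} \<phi> = f (x + h) - f x" if "0 < h" for h
          using int[of x "x + h"] that by (intro integral_unique) auto
        with d show ?thesis
          by (intro that[of d]) auto
      qed
      obtain d2 where d2: "d2 > 0"
        "\<And>h. 0 < h \<Longrightarrow> h < d2 \<Longrightarrow> \<bar>(f x - f (x - h)) / h - \<phi> x\<bar> < e"
      proof -
        obtain d where d: "d > 0"
          "\<And>h. 0 < h \<Longrightarrow> h < d \<Longrightarrow> \<bar>integral {-x..-x + h} (\<lambda>x. \<phi> (- x)) / h - \<phi> x\<bar> < e"
          using S2[OF \<open>-x \<notin> S2\<close> \<open>0 < e\<close>] by (auto simp: divide_inverse_commute)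
        have "integral {-x..-x + h} (\<lambda>x. \<phi> (- x)) = f x - f (x - h)" if "0 < h" for h
          using refl[of "-x" "-x + h"] that by (intro integral_unique) auto
        with d show ?thesis
          by (intro that[of d]) auto
      qed
      show "\<exists>s>0. \<forall>h. h \<noteq> 0 \<and> norm (h - 0) < s \<longrightarrow> norm ((f (x + h) - f x) / h - \<phi> x) < e"
      proof (intro exI[of _ "min d1 d2"] conjI allI impI)
        fix h :: real assume h: "h \<noteq> 0 \<and> norm (h - 0) < min d1 d2"
        show "norm ((f (x + h) - f x) / h - \<phi> x) < e"
        proof (cases "h > 0")
          case True
          then show ?thesis using d1(2)[of h] h by simp
        next
          case False
          moreover have "(f (x + h) - f x) / h = (f x - f (x + h)) / (- h)"
            using h by (simp add: field_simps)
          ultimately show ?thesis using d2(2)[of "- h"] h by simp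
        qed
      qed (use d1 d2 in auto)
    qed
    then show "(f has_real_derivative \<phi> x) (at x)"
      by (simp add: DERIV_def)
  qed
qed

subsection \<open>Positive and negative variation\<close>

lemma lipschitz_deriv_bound:
  fixes f :: "real \<Rightarrow> real"
  assumes "L-lipschitz_on UNIV f" "(f has_real_derivative d) (at x)"
  shows "\<bar>d\<bar> \<le> L"
proof -
  have "(\<lambda>h. \<bar>(f (x + h) - f x) / h\<bar>) \<midarrow>0\<rightarrow> \<bar>d\<bar>"
    using assms(2) by (intro tendsto_rabs) (simp add: DERIV_def)
  moreover have "\<forall>\<^sub>F h in at 0. \<bar>(f (x + h) - f x) / h\<bar> \<le> L"
  proof (rule eventually_at_filter[THEN iffD2], rule always_eventually, intro allI impI)
    fix h :: real assume "h \<noteq> 0"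
    then show "\<bar>(f (x + h) - f x) / h\<bar> \<le> L"
      using lipschitz_onD[OF assms(1), of "x + h" x] by (simp add: dist_real_def field_simps)
  qed
  ultimately show ?thesis
    by (rule tendsto_upperbound) simp
qed

text \<open>Clamping is itself 1-Lipschitz. The extension makes the results on the whole line
  available for functions on an interval.\<close>

lemma lipschitz_clamp:
  fixes f :: "real \<Rightarrow> real"
  assumes "L-lipschitz_on {a..b} f" "a \<le> b"
  shows "L-lipschitz_on UNIV (\<lambda>t. f (max a (min b t)))"
proof (rule lipschitz_onI)
  show "0 \<le> L"
    using assms(1) by (rule lipschitz_on_nonneg)
  fix s t :: real
  have "dist (f (max a (min b s))) (f (max a (min b t))) \<le> L * dist (max a (min b s)) (max a (min b t))"
    using assms by (intro lipschitz_onD[OF assms(1)]) auto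
  also have "\<dots> \<le> L * dist s t"
    using \<open>0 \<le> L\<close> by (intro mult_left_mono) (auto simp: dist_real_def)
  finally show "dist (f (max a (min b s))) (f (max a (min b t))) \<le> L * dist s t" .
qed

lemma indefinite_integral_increment:
  fixes \<psi> :: "real \<Rightarrow> real"
  assumes "\<psi> integrable_on {a..b}" "\<And>x. 0 \<le> \<psi> x" "\<And>x. \<psi> x \<le> L" "a \<le> s" "s \<le> t" "t \<le> b"
  shows "integral {a..t} \<psi> - integral {a..s} \<psi> = integral {s..t} \<psi>"
    and "0 \<le> integral {s..t} \<psi>" "integral {s..t} \<psi> \<le> L * (t - s)"
proof -
  have int: "\<psi> integrable_on {a..t}" "\<psi> integrable_on {s..t}"
    using assms by (auto intro: integrable_on_subinterval[OF assms(1)])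
  show "integral {a..t} \<psi> - integral {a..s} \<psi> = integral {s..t} \<psi>"
    using Henstock_Kurzweil_Integration.integral_combine[OF assms(4,5) int(1)] by simp
  show "0 \<le> integral {s..t} \<psi>"
    using assms by (intro integral_nonneg int) auto
  have "integral {s..t} \<psi> \<le> integral {s..t} (\<lambda>x. L)"
    using assms by (intro integral_le int) auto
  then show "integral {s..t} \<psi> \<le> L * (t - s)"
    using assms by (simp add: mult.commute)
qed

text \<open>\<open>P\<close> and \<open>N\<close> integrate the positive and the negative part of
  the derivative. It exists almost everywhere, so its sign at the points of differentiability alone
  decides whether \<open>P\<close> or \<open>N\<close> is constant on a subinterval.\<close>

lemma lipschitz_jordan_decomposition:
  fixes f :: "real \<Rightarrow> real"
  assumes lip: "L-lipschitz_on {a..b} f" and "0 < L" "a \<le> b"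
  obtains P N where
    "P a = 0" "N a = 0"
    "\<And>t. t \<in> {a..b} \<Longrightarrow> f t = f a + P t - N t"
    "\<And>s t. \<lbrakk>a \<le> s; s \<le> t; t \<le> b\<rbrakk> \<Longrightarrow> P s \<le> P t \<and> P t - P s \<le> L * (t - s)"
    "\<And>s t. \<lbrakk>a \<le> s; s \<le> t; t \<le> b\<rbrakk> \<Longrightarrow> N s \<le> N t \<and> N t - N s \<le> L * (t - s)"
    "\<And>s t. \<lbrakk>a \<le> s; s \<le> t; t \<le> b;
       \<And>u d. \<lbrakk>s < u; u < t; (f has_real_derivative d) (at u)\<rbrakk> \<Longrightarrow> d \<le> 0\<rbrakk> \<Longrightarrow> P t = P s"
    "\<And>s t. \<lbrakk>a \<le> s; s \<le> t; t \<le> b;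
       \<And>u d. \<lbrakk>s < u; u < t; (f has_real_derivative d) (at u)\<rbrakk> \<Longrightarrow> 0 \<le> d\<rbrakk> \<Longrightarrow> N t = N s"
proof -
  define g where "g t = f (max a (min b t))" for t
  have g_lip: "L-lipschitz_on UNIV g"
    using lipschitz_clamp[OF lip \<open>a \<le> b\<close>] by (simp add: g_def[abs_def])
  have g_eq: "g t = f t" if "t \<in> {a..b}" for t
    using that by (simp add: g_def)
  obtain \<phi> where \<phi>: "\<And>a b. a \<le> b \<Longrightarrow> (\<phi> has_integral g b - g a) {a..b}"
    using lipschitz_has_integral_density[OF g_lip \<open>0 < L\<close>] by blast
  obtain S where S: "negligible S" "\<And>x. x \<notin> S \<Longrightarrow> (g has_real_derivative \<phi> x) (at x)"
    using indefinite_integral_has_derivative_ae[of \<phi> g] \<phi> by blast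
  \<comment> \<open>With the value 0 on the exceptional set, \<open>\<psi>\<close> is bounded by
    \<open>L\<close> everywhere and at each interior point is 0 or the derivative of
    \<open>f\<close>.\<close>
  define \<psi> where "\<psi> x = (if x \<in> S then 0 else \<phi> x)" for x
  have \<psi>_int: "(\<psi> has_integral g t - g s) {s..t}" if "s \<le> t" for s t
    by (rule has_integral_spike[OF S(1) _ \<phi>[OF that]]) (simp add: \<psi>_def)
  have \<psi>_deriv: "\<psi> x = 0 \<or> (f has_real_derivative \<psi> x) (at x)" if "a < x" "x < b" for x
  proof -
    have "(f has_real_derivative \<psi> x) (at x)" if "x \<notin> S"
    proof (rule has_field_derivative_transform_within_open[of g _ _ "{a<..<b}"])
      show "(g has_real_derivative \<psi> x) (at x)"
        using S(2)[OF that] that by (simp add: \<psi>_def)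
    qed (use \<open>a < x\<close> \<open>x < b\<close> g_eq in auto)
    then show ?thesis
      by (auto simp: \<psi>_def)
  qed
  have \<psi>_bound: "\<bar>\<psi> x\<bar> \<le> L" for x
    using lipschitz_deriv_bound[OF g_lip S(2)] \<open>0 < L\<close> by (auto simp: \<psi>_def)
  have "\<psi> absolutely_integrable_on {a..b}"
    using \<psi>_bound \<psi>_int[OF \<open>a \<le> b\<close>]
    by (intro absolutely_integrable_integrable_bound[where g="\<lambda>x. L"]) (auto simp: integrable_on_def)
  moreover from this have "(\<lambda>x. - \<psi> x) absolutely_integrable_on {a..b}"
    by (simp add: absolutely_integrable_on_def integrable_neg)
  ultimately have "(\<lambda>x. max (\<psi> x) 0) absolutely_integrable_on {a..b}"
    "(\<lambda>x. max (- \<psi> x) 0) absolutely_integrable_on {a..b}"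
    by (auto intro!: absolutely_integrable_max_1 absolutely_integrable_on_const)
  then have int: "(\<lambda>x. max (\<psi> x) 0) integrable_on {a..b}" "(\<lambda>x. max (- \<psi> x) 0) integrable_on {a..b}"
    by (auto simp: absolutely_integrable_on_def)
  have bound: "max (\<psi> x) 0 \<le> L" "max (- \<psi> x) 0 \<le> L" for x
    using \<psi>_bound[of x] \<open>0 < L\<close> by auto
  define P where "P t = integral {a..t} (\<lambda>x. max (\<psi> x) 0)" for t
  define N where "N t = integral {a..t} (\<lambda>x. max (- \<psi> x) 0)" for t
  note P_incr = indefinite_integral_increment[OF int(1) _ bound(1), folded P_def]
  note N_incr = indefinite_integral_increment[OF int(2) _ bound(2), folded N_def]
  show ?thesis
  proof (rule that[of P N])
    fix t assume t: "t \<in> {a..b}"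
    have sub: "{a..t} \<subseteq> {a..b}"
      using t by auto
    have "P t - N t = integral {a..t} (\<lambda>x. max (\<psi> x) 0 - max (- \<psi> x) 0)"
      unfolding P_def N_def using integrable_on_subinterval[OF int(1) sub] integrable_on_subinterval[OF int(2) sub]
      by (rule integral_diff[symmetric])
    also have "(\<lambda>x. max (\<psi> x) 0 - max (- \<psi> x) 0) = \<psi>"
      by auto
    also have "integral {a..t} \<psi> = f t - f a"
      using \<psi>_int[of a t] t g_eq by (intro integral_unique) auto
    finally show "f t = f a + P t - N t"
      by simp
  next
    fix s t assume st: "a \<le> s" "s \<le> t" "t \<le> b"
    show "P s \<le> P t \<and> P t - P s \<le> L * (t - s)" "N s \<le> N t \<and> N t - N s \<le> L * (t - s)"
      using P_incr[OF _ st] N_incr[OF _ st] by auto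
  next
    fix s t assume st: "a \<le> s" "s \<le> t" "t \<le> b"
      and d: "\<And>u d. \<lbrakk>s < u; u < t; (f has_real_derivative d) (at u)\<rbrakk> \<Longrightarrow> d \<le> 0"
    have "integral {s..t} (\<lambda>x. max (\<psi> x) 0) = integral {s..t} (\<lambda>x. 0)"
    \<comment> \<open>The endpoints are discarded because the sign hypothesis covers only the open
      interval.\<close>
    proof (rule integral_spike[of "{s, t}"])
      fix x assume x: "x \<in> {s..t} - {s, t}"
      then show "0 = max (\<psi> x) 0"
        using \<psi>_deriv[of x] d[of x "\<psi> x"] st by auto
    qed auto
    then show "P t = P s"
      using P_incr(1)[OF _ st] by simp
  next
    fix s t assume st: "a \<le> s" "s \<le> t" "t \<le> b"
      and d: "\<And>u d. \<lbrakk>s < u; u < t; (f has_real_derivative d) (at u)\<rbrakk> \<Longrightarrow> 0 \<le> d"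
    have "integral {s..t} (\<lambda>x. max (- \<psi> x) 0) = integral {s..t} (\<lambda>x. 0)"
    proof (rule integral_spike[of "{s, t}"])
      fix x assume x: "x \<in> {s..t} - {s, t}"
      then show "0 = max (- \<psi> x) 0"
        using \<psi>_deriv[of x] d[of x "\<psi> x"] st by auto
    qed auto
    then show "N t = N s"
      using N_incr(1)[OF _ st] by simp
  qed (simp_all add: P_def N_def)
qed

subsection \<open>Copulas and quasi-copulas\<close>

lemma quasi_copula_transpose: "quasi_copula Q \<Longrightarrow> quasi_copula (\<lambda>x y. Q y x)"
  unfolding quasi_copula_def by blast

lemma copula_transpose:
  assumes "copula C"
  shows "copula (\<lambda>x y. C y x)"
  unfolding copula_def
proof (intro conjI ballI impI)
  fix a b c d :: real
  assume *: "a \<in> {0..1}" "b \<in> {0..1}" "c \<in> {0..1}" "d \<in> {0..1}" "a \<le> b" "c \<le> d"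
  then have "0 \<le> C d b + C c a - C d a - C c b"
    using assms unfolding copula_def by blast
  then show "0 \<le> C d b + C c a - C c b - C d a"
    by simp
qed (use assms in \<open>auto simp: copula_def\<close>)

lemma copula_rect:
  assumes "copula C" "0 \<le> a" "a \<le> b" "b \<le> 1" "0 \<le> c" "c \<le> d" "d \<le> 1"
  shows "C b c + C a d \<le> C b d + C a c"
proof -
  have "0 \<le> C b d + C a c - C b c - C a d"
    using assms unfolding copula_def by auto
  then show ?thesis
    by simp
qed

text \<open>Rectangle inequalities for \<open>[a, b]\<close> times \<open>[0, y]\<close> and times
  \<open>[y, 1]\<close>.\<close>

lemma copula_fst:
  assumes "copula C" "0 \<le> a" "a \<le> b" "b \<le> 1" "y \<in> {0..1}"
  shows "C a y \<le> C b y" "C b y - C a y \<le> b - a"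
proof -
  have *: "C x 0 = 0" "C x 1 = x" if "x \<in> {0..1}" for x
    using assms(1) that by (auto simp: copula_def)
  show "C a y \<le> C b y"
    using copula_rect[of C a b 0 y] *[of a] *[of b] assms by simp
  show "C b y - C a y \<le> b - a"
    using copula_rect[of C a b y 1] *[of a] *[of b] assms by simp
qed

lemma copula_snd:
  assumes "copula C" "0 \<le> a" "a \<le> b" "b \<le> 1" "y \<in> {0..1}"
  shows "C y a \<le> C y b" "C y b - C y a \<le> b - a"
  using copula_fst[OF copula_transpose[OF assms(1)] assms(2-5)] by auto

text \<open>Copulas therefore compete in the supremum \<open>A_delta\<close>, which yields
  \<open>C_upper \<le> A_delta\<close>.\<close>

lemma copula_imp_quasi_copula:
  assumes "copula C"
  shows "quasi_copula C"
  unfolding quasi_copula_def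
proof (intro conjI)
  show "\<forall>x1\<in>{0..1}. \<forall>x2\<in>{0..1}. \<forall>y\<in>{0..1}. x1 \<le> x2 \<longrightarrow> C x1 y \<le> C x2 y \<and> C y x1 \<le> C y x2"
    using copula_fst[OF assms] copula_snd[OF assms] by auto
  show "\<forall>x1\<in>{0..1}. \<forall>x2\<in>{0..1}. \<forall>y\<in>{0..1}.
      \<bar>C x1 y - C x2 y\<bar> \<le> \<bar>x1 - x2\<bar> \<and> \<bar>C y x1 - C y x2\<bar> \<le> \<bar>x1 - x2\<bar>"
  proof (intro ballI)
    fix x1 x2 y :: real assume *: "x1 \<in> {0..1}" "x2 \<in> {0..1}" "y \<in> {0..1}"
    then show "\<bar>C x1 y - C x2 y\<bar> \<le> \<bar>x1 - x2\<bar> \<and> \<bar>C y x1 - C y x2\<bar> \<le> \<bar>x1 - x2\<bar>"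
      using copula_fst[OF assms, of x1 x2 y] copula_fst[OF assms, of x2 x1 y]
        copula_snd[OF assms, of x1 x2 y] copula_snd[OF assms, of x2 x1 y]
      by (cases "x1 \<le> x2") auto
  qed
qed (use assms in \<open>auto simp: copula_def\<close>)

text \<open>Each summand is the distribution function of the monotone coupling of two mass
  distributions. Their total masses match by \<open>U 1 = W 1\<close>, and the marginals of the two
  couplings add up to the uniform ones.\<close>

lemma copula_sum_of_min:
  fixes U U' W W' :: "real \<Rightarrow> real"
  assumes mono: "mono_on {0..1} U" "mono_on {0..1} U'" "mono_on {0..1} W" "mono_on {0..1} W'"
    and sum: "\<And>t. t \<in> {0..1} \<Longrightarrow> U t + U' t = t" "\<And>t. t \<in> {0..1} \<Longrightarrow> W t + W' t = t"
    and zero: "U 0 = 0" "W 0 = 0"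
    and one: "U 1 = W 1"
  shows "copula (\<lambda>s t. min (U s) (W t) + min (U' s) (W' t))"
proof -
  have zero': "U' 0 = 0" "W' 0 = 0" and one': "U' 1 = W' 1"
    using sum(1)[of 0] sum(2)[of 0] sum(1)[of 1] sum(2)[of 1] zero one by auto
  have lo: "0 \<le> U t" "0 \<le> U' t" "0 \<le> W t" "0 \<le> W' t" if "t \<in> {0..1}" for t
    using mono[THEN mono_onD, of 0 t] that zero zero' by auto
  have hi: "U t \<le> U 1" "U' t \<le> U' 1" "W t \<le> W 1" "W' t \<le> W' 1" if "t \<in> {0..1}" for t
    using mono[THEN mono_onD, of t 1] that by auto
  \<comment> \<open>For increasing \<open>U\<close> and \<open>W\<close> this is the rectangle
    inequality of one summand.\<close>
  have supermodular: "min b c + min a d \<le> min b d + min a c" if "a \<le> b" "c \<le> d" for a b c d :: real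
    using that by (auto simp: min_def)
  show ?thesis
    unfolding copula_def
  proof (intro conjI ballI impI)
    fix x y :: real assume "x \<in> {0..1}" "y \<in> {0..1}"
    then show "min (U x) (W y) + min (U' x) (W' y) \<in> {0..1}"
      using lo[of x] lo[of y] sum(1)[of x] by (auto simp: min_def)
  next
    fix x :: real assume x: "x \<in> {0..1}"
    show "min (U x) (W 0) + min (U' x) (W' 0) = 0" "min (U 0) (W x) + min (U' 0) (W' x) = 0"
      using lo[OF x] zero zero' by auto
    show "min (U x) (W 1) + min (U' x) (W' 1) = x" "min (U 1) (W x) + min (U' 1) (W' x) = x"
      using hi[OF x] sum[OF x] one one' by auto
  next
    fix a b c d :: real
    assume "a \<in> {0..1}" "b \<in> {0..1}" "c \<in> {0..1}" "d \<in> {0..1}" "a \<le> b" "c \<le> d"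
    then have "U a \<le> U b" "U' a \<le> U' b" "W c \<le> W d" "W' c \<le> W' d"
      using mono[THEN mono_onD, of a b] mono[THEN mono_onD, of c d] by auto
    then show "0 \<le> min (U b) (W d) + min (U' b) (W' d) + (min (U a) (W c) + min (U' a) (W' c))
        - (min (U b) (W c) + min (U' b) (W' c)) - (min (U a) (W d) + min (U' a) (W' d))"
      using supermodular[of "U a" "U b" "W c" "W d"] supermodular[of "U' a" "U' b" "W' c" "W' d"] by simp
  qed
qed

section \<open>Diagonal sections and the quasi-copulas carrying them\<close>

lemma
  assumes "diagonal_section \<delta>"
  shows delta_hat_nonneg: "t \<in> {0..1} \<Longrightarrow> 0 \<le> delta_hat \<delta> t"
    and delta_hat_0: "delta_hat \<delta> 0 = 0"
    and delta_hat_1: "delta_hat \<delta> 1 = 0"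
    and delta_hat_lipschitz: "1-lipschitz_on {0..1} (delta_hat \<delta>)"
proof -
  have \<delta>: "\<And>x. x \<in> {0..1} \<Longrightarrow> 0 \<le> \<delta> x \<and> \<delta> x \<le> x" "\<delta> 1 = 1"
    "\<And>x y. \<lbrakk>0 \<le> x; x \<le> y; y \<le> 1\<rbrakk> \<Longrightarrow> 0 \<le> \<delta> y - \<delta> x \<and> \<delta> y - \<delta> x \<le> 2 * (y - x)"
    using assms by (auto simp: diagonal_section_def)
  show "t \<in> {0..1} \<Longrightarrow> 0 \<le> delta_hat \<delta> t" "delta_hat \<delta> 0 = 0" "delta_hat \<delta> 1 = 0"
    using \<delta>(1)[of t] \<delta>(1)[of 0] \<delta>(2) by (auto simp: delta_hat_def)
  \<comment> \<open>Slopes of \<open>\<delta>\<close> in \<open>[0, 2]\<close> become slopes of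
    \<open>delta_hat \<delta>\<close> in \<open>[-1, 1]\<close>.\<close>
  show "1-lipschitz_on {0..1} (delta_hat \<delta>)"
  proof (rule lipschitz_onI)
    fix x y :: real assume "x \<in> {0..1}" "y \<in> {0..1}"
    then show "dist (delta_hat \<delta> x) (delta_hat \<delta> y) \<le> 1 * dist x y"
      using \<delta>(3)[of x y] \<delta>(3)[of y x] by (cases "x \<le> y") (auto simp: dist_real_def delta_hat_def)
  qed simp
qed

text \<open>The infimum over \<open>u\<close> of the largest quasi-copulas taking the value \<open>\<delta> u\<close> at \<open>(u, u)\<close>.\<close>

definition diagonal_envelope :: "(real \<Rightarrow> real) \<Rightarrow> real \<Rightarrow> real \<Rightarrow> real" where
  "diagonal_envelope \<delta> x y = min (min x y) (INF u\<in>{0..1}. \<delta> u + max 0 (x - u) + max 0 (y - u))"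

lemma le_diagonal_envelopeI:
  assumes "z \<le> x" "z \<le> y" "\<And>u. u \<in> {0..1} \<Longrightarrow> z \<le> \<delta> u + max 0 (x - u) + max 0 (y - u)"
  shows "z \<le> diagonal_envelope \<delta> x y"
  unfolding diagonal_envelope_def using assms by (auto intro!: cINF_greatest)

lemma diagonal_envelope_le:
  assumes "diagonal_section \<delta>"
  shows "diagonal_envelope \<delta> x y \<le> x" "diagonal_envelope \<delta> x y \<le> y"
    and "u \<in> {0..1} \<Longrightarrow> diagonal_envelope \<delta> x y \<le> \<delta> u + max 0 (x - u) + max 0 (y - u)"
proof -
  have bdd: "bdd_below ((\<lambda>u. \<delta> u + max 0 (x - u) + max 0 (y - u)) ` {0..1})"
    using assms by (intro bdd_belowI[of _ 0]) (auto simp: diagonal_section_def intro!: add_nonneg_nonneg)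
  show "diagonal_envelope \<delta> x y \<le> \<delta> u + max 0 (x - u) + max 0 (y - u)" if "u \<in> {0..1}"
    unfolding diagonal_envelope_def using cINF_lower[OF bdd that] by linarith
qed (auto simp: diagonal_envelope_def)

lemma diagonal_envelope_commute: "diagonal_envelope \<delta> x y = diagonal_envelope \<delta> y x"
  by (simp add: diagonal_envelope_def min.commute add.commute add.left_commute)

text \<open>Every function under the infimum is increasing and 1-Lipschitz in \<open>x\<close> and
  in \<open>y\<close>, and the infimum inherits this. On the diagonal at \<open>t\<close>, the
  choice \<open>u = t\<close> bounds it above and the growth of \<open>\<delta>\<close> bounds it
  below.\<close>

lemma
  assumes \<delta>: "diagonal_section \<delta>"
  shows quasi_copula_diagonal_envelope: "quasi_copula (diagonal_envelope \<delta>)"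
    and has_diagonal_diagonal_envelope: "has_diagonal (diagonal_envelope \<delta>) \<delta>"
proof -
  let ?E = "diagonal_envelope \<delta>"
  note le = diagonal_envelope_le[OF \<delta>]
  \<comment> \<open>The third bound compares \<open>u\<close> with 1; it gives the envelope the
    value \<open>x\<close> on the side \<open>y = 1\<close>.\<close>
  have d: "0 \<le> \<delta> u" "\<delta> u \<le> u" "2 * u - 1 \<le> \<delta> u" if "u \<in> {0..1}" for u
    using \<delta> that by (force simp: diagonal_section_def)+
  have nonneg: "0 \<le> ?E x y" if "0 \<le> x" "0 \<le> y" for x y
    using that d(1) by (intro le_diagonal_envelopeI) (auto intro!: add_nonneg_nonneg)
  have zero: "?E x 0 = 0" if "0 \<le> x" for x
    using le(2)[of x 0] nonneg[of x 0] that by simp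
  have one: "?E x 1 = x" if "x \<in> {0..1}" for x
  proof (rule antisym)
    show "x \<le> ?E x 1"
    proof (rule le_diagonal_envelopeI)
      fix u :: real assume "u \<in> {0..1}"
      then show "x \<le> \<delta> u + max 0 (x - u) + max 0 (1 - u)"
        using d(3)[of u] by auto
    qed (use that in auto)
  qed (rule le(1))
  have mono: "?E x y \<le> ?E x' y" if "x \<le> x'" for x x' y
  proof (rule le_diagonal_envelopeI)
    fix u :: real assume "u \<in> {0..1}"
    then show "?E x y \<le> \<delta> u + max 0 (x' - u) + max 0 (y - u)"
      using le(3)[of u x y] that by linarith
  qed (use le(1,2)[of x y] that in auto)
  have lip: "?E x' y - (x' - x) \<le> ?E x y" if "x \<le> x'" for x x' y
  proof (rule le_diagonal_envelopeI)
    fix u :: real assume "u \<in> {0..1}"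
    then show "?E x' y - (x' - x) \<le> \<delta> u + max 0 (x - u) + max 0 (y - u)"
      using le(3)[of u x' y] that by linarith
  qed (use le(1,2)[of x' y] that in auto)
  have lip_abs: "\<bar>?E x y - ?E x' y\<bar> \<le> \<bar>x - x'\<bar>" for x x' y
    using mono[of x x' y] mono[of x' x y] lip[of x x' y] lip[of x' x y] by linarith
  show "quasi_copula ?E"
    unfolding quasi_copula_def
  proof (intro conjI ballI impI)
    fix x y :: real assume "x \<in> {0..1}" "y \<in> {0..1}"
    then show "?E x y \<in> {0..1}"
      using nonneg[of x y] le(1)[of x y] by auto
  next
    fix x :: real assume "x \<in> {0..1}"
    then show "?E x 0 = 0" "?E 0 x = 0" "?E x 1 = x" "?E 1 x = x"
      using zero[of x] one[of x] diagonal_envelope_commute[of \<delta> x] by auto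
  next
    fix x1 x2 y :: real assume "x1 \<le> x2"
    then show "?E x1 y \<le> ?E x2 y" "?E y x1 \<le> ?E y x2"
      using mono[of x1 x2 y] diagonal_envelope_commute[of \<delta> y] by auto
  next
    fix x1 x2 y :: real
    show "\<bar>?E x1 y - ?E x2 y\<bar> \<le> \<bar>x1 - x2\<bar>" "\<bar>?E y x1 - ?E y x2\<bar> \<le> \<bar>x1 - x2\<bar>"
      using lip_abs[of x1 y x2] diagonal_envelope_commute[of \<delta> y] by auto
  qed
  show "has_diagonal ?E \<delta>"
    unfolding has_diagonal_def
  proof
    fix t :: real assume t: "t \<in> {0..1}"
    show "?E t t = \<delta> t"
    proof (rule antisym)
      show "?E t t \<le> \<delta> t"
        using le(3)[OF t, of t t] by simp
      show "\<delta> t \<le> ?E t t"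
      proof (rule le_diagonal_envelopeI)
        fix u :: real assume u: "u \<in> {0..1}"
        have "u \<le> t \<Longrightarrow> \<delta> t - \<delta> u \<le> 2 * (t - u)" "t \<le> u \<Longrightarrow> \<delta> t \<le> \<delta> u"
          using \<delta> t u by (force simp: diagonal_section_def)+
        then show "\<delta> t \<le> \<delta> u + max 0 (t - u) + max 0 (t - u)"
          by (cases "u \<le> t") auto
      qed (use d(2)[OF t] in auto)
    qed
  qed
qed

text \<open>A point \<open>u\<close> in \<open>[s, t]\<close> imposes the bound
  \<open>t - delta_hat \<delta> u\<close>. Points left of \<open>s\<close> restrict no more than
  \<open>s\<close>, and points right of \<open>t\<close> no more than \<open>t\<close>.\<close>

lemma diagonal_envelope_ge:
  assumes \<delta>: "diagonal_section \<delta>" and st: "0 \<le> s" "s \<le> t" "t \<le> 1"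
    and M: "\<And>u. u \<in> {s..t} \<Longrightarrow> delta_hat \<delta> u \<le> M"
  shows "min s (t - M) \<le> diagonal_envelope \<delta> s t"
proof (rule le_diagonal_envelopeI)
  fix u :: real assume u: "u \<in> {0..1}"
  have \<delta>_incr: "0 \<le> \<delta> y - \<delta> x \<and> \<delta> y - \<delta> x \<le> 2 * (y - x)" if "0 \<le> x" "x \<le> y" "y \<le> 1" for x y
    using \<delta> that by (auto simp: diagonal_section_def)
  consider "u < s" | "s \<le> u" "u \<le> t" | "t < u"
    by linarith
  then have "t - M \<le> \<delta> u + max 0 (s - u) + max 0 (t - u)"
  proof cases
    case 1
    then show ?thesis
      using M[of s] \<delta>_incr[of u s] u st by (simp add: delta_hat_def)
  next
    case 2
    then show ?thesis
      using M[of u] by (simp add: delta_hat_def)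
  next
    case 3
    then show ?thesis
      using M[of t] \<delta>_incr[of t u] u st by (simp add: delta_hat_def)
  qed
  then show "min s (t - M) \<le> \<delta> u + max 0 (s - u) + max 0 (t - u)"
    by simp
qed (use st in auto)

section \<open>Bounds for the two suprema\<close>

lemma le_A_delta:
  assumes "quasi_copula Q" "has_diagonal Q \<delta>" "x \<in> {0..1}" "y \<in> {0..1}"
  shows "Q x y \<le> A_delta \<delta> x y"
  unfolding A_delta_def
proof (rule cSup_upper)
  show "bdd_above {Q x y | Q. quasi_copula Q \<and> has_diagonal Q \<delta>}"
    using assms(3,4) by (intro bdd_aboveI[of _ 1]) (auto simp: quasi_copula_def)
qed (use assms in auto)

text \<open>The envelope shows that the set of competitors is nonempty, as a least upper bound of
  reals requires.\<close>

lemma A_delta_le: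
  assumes "diagonal_section \<delta>" "\<And>Q. \<lbrakk>quasi_copula Q; has_diagonal Q \<delta>\<rbrakk> \<Longrightarrow> Q x y \<le> z"
  shows "A_delta \<delta> x y \<le> z"
  unfolding A_delta_def
  using quasi_copula_diagonal_envelope[OF assms(1)] has_diagonal_diagonal_envelope[OF assms(1)] assms(2)
  by (intro cSup_least) auto

lemma le_C_upper:
  assumes "copula C" "has_diagonal C \<delta>" "x \<in> {0..1}" "y \<in> {0..1}"
  shows "C x y \<le> C_upper \<delta> x y"
  unfolding C_upper_def
proof (rule cSup_upper)
  show "bdd_above {C x y | C. copula C \<and> has_diagonal C \<delta>}"
    using assms(3,4) by (intro bdd_aboveI[of _ 1]) (auto simp: copula_def)
qed (use assms in auto)

lemma C_upper_le:
  assumes "copula K" "has_diagonal K \<delta>" "\<And>C. \<lbrakk>copula C; has_diagonal C \<delta>\<rbrakk> \<Longrightarrow> C x y \<le> z"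
  shows "C_upper \<delta> x y \<le> z"
  unfolding C_upper_def using assms by (intro cSup_least) auto

text \<open>Monotonicity leads from \<open>(x, y)\<close> to \<open>(u, y)\<close>, and the
  Lipschitz bound from there to \<open>(u, u)\<close> costs \<open>y - u\<close>.\<close>

lemma quasi_copula_le:
  assumes Q: "quasi_copula Q" "has_diagonal Q \<delta>" and "0 \<le> x" "x \<le> u" "u \<le> y" "y \<le> 1"
  shows "Q x y \<le> x" "Q x y \<le> y - delta_hat \<delta> u"
proof -
  have mono: "\<And>a b c. \<lbrakk>a \<in> {0..1}; b \<in> {0..1}; c \<in> {0..1}; a \<le> b\<rbrakk> \<Longrightarrow> Q a c \<le> Q b c \<and> Q c a \<le> Q c b"
    and lip: "\<And>a b c. \<lbrakk>a \<in> {0..1}; b \<in> {0..1}; c \<in> {0..1}\<rbrakk> \<Longrightarrow> \<bar>Q c a - Q c b\<bar> \<le> \<bar>a - b\<bar>"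
    and one: "\<And>a. a \<in> {0..1} \<Longrightarrow> Q a 1 = a"
    using Q(1) by (auto simp: quasi_copula_def)
  have "Q u u = \<delta> u"
    using assms by (auto simp: has_diagonal_def)
  then show "Q x y \<le> y - delta_hat \<delta> u"
    using mono[of x u y] lip[of y u u] assms by (auto simp: delta_hat_def)
  show "Q x y \<le> x"
    using mono[of y 1 x] one[of x] assms by auto
qed

text \<open>With \<open>h v = v - C s v\<close>, both \<open>h\<close> and \<open>h - delta_hat \<delta>\<close> increase on \<open>[s, 1]\<close> and \<open>h s = delta_hat \<delta> s\<close>, so
  \<open>h t\<close> dominates \<open>delta_hat \<delta> s\<close> plus the positive variation of \<open>delta_hat \<delta>\<close> on \<open>[s, t]\<close>.\<close>

lemma copula_gap:
  assumes C: "copula C" "has_diagonal C \<delta>" and "0 \<le> s" "s \<le> a" "a \<le> b" "b \<le> 1"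
  shows "a - C s a \<le> b - C s b"
    and "delta_hat \<delta> b - delta_hat \<delta> a \<le> (b - C s b) - (a - C s a)"
proof -
  show "a - C s a \<le> b - C s b"
    using copula_snd(2)[OF C(1), of a b s] assms by auto
  \<comment> \<open>The mass of \<open>[0, s]\<close> times \<open>[a, b]\<close> is at most that of
    \<open>[0, a]\<close> times \<open>[a, b]\<close>, hence at most
    \<open>\<delta> b - \<delta> a\<close>.\<close>
  have "C a a = \<delta> a" "C b b = \<delta> b"
    using assms by (auto simp: has_diagonal_def)
  moreover have "C a b \<le> C b b"
    using copula_fst(1)[OF C(1), of a b b] assms by auto
  moreover have "C a a + C s b \<le> C a b + C s a"
    using copula_rect[OF C(1), of s a a b] assms by auto
  ultimately show "delta_hat \<delta> b - delta_hat \<delta> a \<le> (b - C s b) - (a - C s a)"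
    by (simp add: delta_hat_def)
qed

subsection \<open>The extremal copula\<close>

text \<open>The first summand of \<open>K\<close> couples \<open>s - N s\<close> with
  \<open>t - P t\<close> and carries the mass above the diagonal; the second couples
  \<open>N\<close> with \<open>P\<close> and carries the mass below. As \<open>N \<le> P\<close>,
  for \<open>x \<le> y\<close> the second minimum is \<open>N x\<close>, which leaves the stated
  value.\<close>

lemma
  assumes \<delta>: "diagonal_section \<delta>"
    and zero: "P 0 = 0" "N 0 = 0"
    and dec: "\<And>t. t \<in> {0..1} \<Longrightarrow> delta_hat \<delta> t = P t - N t"
    and P: "\<And>s t. \<lbrakk>0 \<le> s; s \<le> t; t \<le> 1\<rbrakk> \<Longrightarrow> P s \<le> P t \<and> P t - P s \<le> t - s"
    and N: "\<And>s t. \<lbrakk>0 \<le> s; s \<le> t; t \<le> 1\<rbrakk> \<Longrightarrow> N s \<le> N t \<and> N t - N s \<le> t - s"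
  defines "K \<equiv> \<lambda>s t. min (s - N s) (t - P t) + min (N s) (P t)"
  shows copula_of_variations: "copula K"
    and has_diagonal_of_variations: "has_diagonal K \<delta>"
    and copula_of_variations_above: "\<lbrakk>0 \<le> x; x \<le> y; y \<le> 1\<rbrakk> \<Longrightarrow> K x y = min x (y - (P y - N x))"
proof -
  have N_le_P: "N t \<le> P t" if "t \<in> {0..1}" for t
    using dec[OF that] delta_hat_nonneg[OF \<delta> that] by simp
  show "copula K"
    unfolding K_def
  proof (rule copula_sum_of_min)
    show "mono_on {0..1} (\<lambda>s. s - N s)" "mono_on {0..1} N" "mono_on {0..1} (\<lambda>s. s - P s)" "mono_on {0..1} P"
      by (rule mono_onI; use P N in \<open>force simp: algebra_simps\<close>)+
    \<comment> \<open>The total masses agree because \<open>delta_hat \<delta>\<close> vanishes at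
      1.\<close>
    show "1 - N 1 = 1 - P 1"
      using dec[of 1] delta_hat_1[OF \<delta>] by simp
  qed (use zero in auto)
  show "has_diagonal K \<delta>"
    unfolding has_diagonal_def
  proof
    fix t :: real assume "t \<in> {0..1}"
    with dec[OF this] N_le_P[OF this] show "K t t = \<delta> t"
      by (simp add: K_def delta_hat_def)
  qed
  assume xy: "0 \<le> x" "x \<le> y" "y \<le> 1"
  then have "N x \<le> P y"
    using N_le_P[of x] P[of x y] by auto
  then show "K x y = min x (y - (P y - N x))"
    by (simp add: K_def min_def)
qed

text \<open>If some \<open>s\<close> with \<open>f' s < 0\<close> precedes \<open>t\<close> with \<open>f' t > 0\<close>, let \<open>p\<close> be the supremum of such \<open>s\<close>: then
  \<open>N\<close> is constant on \<open>[p, t]\<close> and \<open>f t \<le> t - p\<close>. Otherwise \<open>f\<close> increases up to the last point of positive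
  derivative and decreases after it.\<close>

lemma variation_alternative:
  assumes xy: "0 \<le> x" "x \<le> y" "y \<le> 1"
    and dec: "\<And>t. t \<in> {0..1} \<Longrightarrow> f t = P t - N t"
    and P: "\<And>s t. \<lbrakk>0 \<le> s; s \<le> t; t \<le> 1\<rbrakk> \<Longrightarrow> P s \<le> P t \<and> P t - P s \<le> t - s"
    and N: "\<And>s t. \<lbrakk>0 \<le> s; s \<le> t; t \<le> 1\<rbrakk> \<Longrightarrow> N s \<le> N t \<and> N t - N s \<le> t - s"
    and P_const: "\<And>s t. \<lbrakk>0 \<le> s; s \<le> t; t \<le> 1;
       \<And>u d. \<lbrakk>s < u; u < t; (f has_real_derivative d) (at u)\<rbrakk> \<Longrightarrow> d \<le> 0\<rbrakk> \<Longrightarrow> P t = P s"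
    and N_const: "\<And>s t. \<lbrakk>0 \<le> s; s \<le> t; t \<le> 1;
       \<And>u d. \<lbrakk>s < u; u < t; (f has_real_derivative d) (at u)\<rbrakk> \<Longrightarrow> 0 \<le> d\<rbrakk> \<Longrightarrow> N t = N s"
    and V: "\<And>s t ds dt. \<lbrakk>s \<in> {0..1}; t \<in> {0..1}; s < t; (f has_real_derivative ds) (at s);
       (f has_real_derivative dt) (at t); ds < 0; 0 < dt\<rbrakk> \<Longrightarrow> f t \<le> t - s"
  shows "(\<exists>u\<in>{x..y}. P y - N x = f u) \<or> P y - N x \<le> y - x"
proof -
  define Pos where "Pos = {t. x < t \<and> t < y \<and> (\<exists>d>0. (f has_real_derivative d) (at t))}"
  define Neg where "Neg = {t. x < t \<and> t < y \<and> (\<exists>d<0. (f has_real_derivative d) (at t))}"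
  show ?thesis
  proof (cases "\<exists>t\<in>Pos. \<exists>s\<in>Neg. s < t")
    case True
    then obtain t s where t: "t \<in> Pos" and s: "s \<in> Neg" "s < t"
      by blast
    define p where "p = Sup (Neg \<inter> {..t})"
    have bdd: "bdd_above (Neg \<inter> {..t})"
      by (auto intro: bdd_aboveI[of _ t])
    have p_ge: "r \<le> p" if "r \<in> Neg" "r \<le> t" for r
      unfolding p_def using bdd that by (intro cSup_upper) auto
    have "p \<le> t"
      unfolding p_def using s by (intro cSup_least) auto
    have "x < p"
      using p_ge[of s] s by (auto simp: Neg_def)
    have t': "x < t" "t < y"
      using t by (auto simp: Pos_def)
    have gap: "r \<le> t - f t" if r: "r \<in> Neg" "r \<le> t" for r
    proof -
      have "r \<noteq> t"
        using r t by (auto simp: Neg_def Pos_def dest: DERIV_unique)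
      then show ?thesis
        using r t xy V[of r t] by (fastforce simp: Neg_def Pos_def)
    qed
    have "p \<le> t - f t"
      unfolding p_def using s gap by (intro cSup_least) auto
    moreover have "N t = N p"
    proof (rule N_const)
      fix u d assume u: "p < u" "u < t" "(f has_real_derivative d) (at u)"
      show "0 \<le> d"
      proof (rule ccontr)
        assume "\<not> 0 \<le> d"
        then have "u \<in> Neg"
          using u t' \<open>x < p\<close> by (auto simp: Neg_def intro!: exI[of _ d])
        then show False
          using p_ge[of u] u by simp
      qed
    qed (use xy t' \<open>p \<le> t\<close> \<open>x < p\<close> in auto)
    moreover have "N p - N x \<le> p - x"
      using N[of x p] xy t' \<open>p \<le> t\<close> \<open>x < p\<close> by auto
    moreover have "P y - P t \<le> y - t"
      using P[of t y] xy t' by auto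
    \<comment> \<open>Split at \<open>p\<close> and \<open>t\<close>:
      \<open>P y - N x = (P y - P t) + f t + (N p - N x)\<close>, bounded by
      \<open>(y - t) + (t - p) + (p - x)\<close>.\<close>
    ultimately have "P y - N x \<le> y - x"
      using dec[of t] xy t' by auto
    then show ?thesis ..
  next
    case False
    \<comment> \<open>Inserting \<open>x\<close> keeps the set nonempty; if \<open>Pos\<close> is
      empty, then \<open>u = x\<close>.\<close>
    define u where "u = Sup (insert x Pos)"
    have bdd: "bdd_above (insert x Pos)"
      using xy by (auto intro!: bdd_aboveI[of _ y] simp: Pos_def)
    have u_ge: "r \<le> u" if "r \<in> insert x Pos" for r
      unfolding u_def using bdd that by (intro cSup_upper) auto
    have "x \<le> u"
      using u_ge by simp
    have "u \<le> y"
      unfolding u_def using xy by (intro cSup_least) (auto simp: Pos_def)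
    have "P y = P u"
    proof (rule P_const)
      fix v d assume v: "u < v" "v < y" "(f has_real_derivative d) (at v)"
      show "d \<le> 0"
      proof (rule ccontr)
        assume "\<not> d \<le> 0"
        then have "v \<in> Pos"
          using v \<open>x \<le> u\<close> by (auto simp: Pos_def intro!: exI[of _ d])
        then show False
          using u_ge[of v] v by simp
      qed
    qed (use xy \<open>x \<le> u\<close> \<open>u \<le> y\<close> in auto)
    moreover have "N u = N x"
    proof (rule N_const)
      fix v d assume v: "x < v" "v < u" "(f has_real_derivative d) (at v)"
      \<comment> \<open>As \<open>v < u\<close>, some point of \<open>Pos\<close> lies beyond
        \<open>v\<close>, so a negative derivative at \<open>v\<close> would contradict the case
        assumption.\<close>
      obtain r where "r \<in> insert x Pos" "v < r"
        using v(2) bdd unfolding u_def by (subst (asm) less_cSup_iff) auto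
      then have r: "r \<in> Pos" "v < r"
        using v by auto
      show "0 \<le> d"
      proof (rule ccontr)
        assume "\<not> 0 \<le> d"
        then have "v \<in> Neg"
          using v \<open>u \<le> y\<close> by (auto simp: Neg_def intro!: exI[of _ d])
        then show False
          using False r by blast
      qed
    qed (use xy \<open>x \<le> u\<close> \<open>u \<le> y\<close> in auto)
    ultimately have "P y - N x = f u"
      using dec[of u] xy \<open>x \<le> u\<close> \<open>u \<le> y\<close> by auto
    then show ?thesis
      using \<open>x \<le> u\<close> \<open>u \<le> y\<close> by auto
  qed
qed

section \<open>Necessity of the gap condition\<close>

text \<open>The drop of \<open>delta_hat \<delta>\<close> after \<open>s\<close> and its rise before
  \<open>t\<close> keep every copula below \<open>t\<close> minus the maximum by a fixed amount.
  \<open>A_delta\<close> is at least the minimum of \<open>s\<close> and that bound, so equality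
  forces the minimum to be \<open>s\<close>.\<close>

lemma C_upper_eq_A_delta_imp_gap:
  assumes \<delta>: "diagonal_section \<delta>"
    and K: "copula K" "has_diagonal K \<delta>"
    and st: "s \<in> {0..1}" "t \<in> {0..1}" "s < t"
    and ds: "(delta_hat \<delta> has_real_derivative ds) (at s within {0..1})" "ds < 0"
    and dt: "(delta_hat \<delta> has_real_derivative dt) (at t within {0..1})" "0 < dt"
    and eq: "C_upper \<delta> s t = A_delta \<delta> s t"
  shows "max (delta_hat \<delta> s) (delta_hat \<delta> t) \<le> t - s"
proof -
  let ?f = "delta_hat \<delta>"
  obtain d1 where d1: "d1 > 0" "\<And>h. \<lbrakk>0 < h; s + h \<in> {0..1}; h < d1\<rbrakk> \<Longrightarrow> ?f (s + h) < ?f s"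
    using has_real_derivative_neg_dec_right[OF ds] by blast
  obtain d2 where d2: "d2 > 0" "\<And>h. \<lbrakk>0 < h; t - h \<in> {0..1}; h < d2\<rbrakk> \<Longrightarrow> ?f (t - h) < ?f t"
    using has_real_derivative_pos_inc_left[OF dt] by blast
  \<comment> \<open>Halving makes \<open>h\<close> strictly smaller than \<open>d1\<close> and
    \<open>d2\<close> and keeps \<open>s + h \<le> t - h\<close>.\<close>
  define h where "h = min (min d1 d2) (t - s) / 2"
  have h: "0 < h" "h < d1" "h < d2" "2 * h \<le> t - s"
    using d1(1) d2(1) st unfolding h_def by (auto simp: min_def)
  define a where "a = s + h"
  define b where "b = t - h"
  have ab: "s < a" "a \<le> b" "b < t"
    using h by (auto simp: a_def b_def)
  have fa: "?f a < ?f s" and fb: "?f b < ?f t"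
    unfolding a_def b_def using d1(2)[of h] d2(2)[of h] h st by auto
  \<comment> \<open>This loss depends on \<open>delta_hat \<delta>\<close> alone, so the bound is
    uniform over all copulas and survives the supremum.\<close>
  define e where "e = min (?f s - ?f a) (?f t - ?f b)"
  have e: "0 < e"
    using fa fb by (simp add: e_def)
  have "continuous_on {s..t} ?f"
    using lipschitz_on_continuous_on[OF delta_hat_lipschitz[OF \<delta>]] st
    by (auto intro: continuous_on_subset)
  then obtain u where u: "u \<in> {s..t}" "\<And>v. v \<in> {s..t} \<Longrightarrow> ?f v \<le> ?f u"
    using continuous_attains_sup[of "{s..t}" ?f] st by auto
  have "C s t \<le> t - ?f u - e" if C: "copula C" "has_diagonal C \<delta>" for C
  proof -
    note gap = copula_gap[OF C, of s]
    have hs: "s - C s s = ?f s"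
      using C(2) st by (simp add: has_diagonal_def delta_hat_def)
    have "?f u + e \<le> t - C s t"
    \<comment> \<open>The quantity \<open>v - C s v\<close> cannot follow a decrease of
      \<open>delta_hat \<delta>\<close>. If the maximum is attained after \<open>a\<close>, the drop
      on \<open>[s, a]\<close> is lost; otherwise the rise on \<open>[b, t]\<close> comes on top of
      it.\<close>
    proof (cases "a \<le> u")
      case True
      then show ?thesis
        using gap(1)[of s a] gap(2)[of a u] gap(1)[of u t] hs ab u st by (auto simp: e_def)
    next
      case False
      then show ?thesis
        using gap(2)[of s u] gap(1)[of u b] gap(2)[of b t] hs ab u st by (auto simp: e_def)
    qed
    then show ?thesis
      by simp
  qed
  then have "C_upper \<delta> s t \<le> t - ?f u - e"
    by (rule C_upper_le[OF K])
  moreover have "min s (t - ?f u) \<le> diagonal_envelope \<delta> s t"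
    using st u by (intro diagonal_envelope_ge[OF \<delta>]) auto
  moreover have "diagonal_envelope \<delta> s t \<le> A_delta \<delta> s t"
    using st by (intro le_A_delta quasi_copula_diagonal_envelope has_diagonal_diagonal_envelope \<delta>) auto
  ultimately have "min s (t - ?f u) \<le> t - ?f u - e"
    using eq by simp
  then have "?f u \<le> t - s"
    using e by (auto simp: min_def split: if_splits)
  then show ?thesis
    using u(2)[of s] u(2)[of t] st by auto
qed

theorem theorem3p9:
  fixes \<delta> :: "real \<Rightarrow> real"
  assumes "diagonal_section \<delta>"
  shows "(\<forall>x\<in>{0..1}. \<forall>y\<in>{0..1}. C_upper \<delta> x y = A_delta \<delta> x y) \<longleftrightarrow>
         (\<forall>x\<in>{0..1}. \<forall>y\<in>{0..1}. \<forall>dx dy.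
            x < y \<longrightarrow>
            (delta_hat \<delta> has_real_derivative dx) (at x within {0..1}) \<longrightarrow>
            (delta_hat \<delta> has_real_derivative dy) (at y within {0..1}) \<longrightarrow>
            dx < 0 \<longrightarrow> 0 < dy \<longrightarrow>
            y - x \<ge> max (delta_hat \<delta> x) (delta_hat \<delta> y))"
    (is "?eq \<longleftrightarrow> ?gap")
proof (rule lipschitz_jordan_decomposition[OF delta_hat_lipschitz[OF assms] zero_less_one zero_le_one])
  fix P N :: "real \<Rightarrow> real"
  assume zero: "P 0 = 0" "N 0 = 0"
    and dec0: "\<And>t. t \<in> {0..1} \<Longrightarrow> delta_hat \<delta> t = delta_hat \<delta> 0 + P t - N t"
    and P1: "\<And>s t. \<lbrakk>0 \<le> s; s \<le> t; t \<le> 1\<rbrakk> \<Longrightarrow> P s \<le> P t \<and> P t - P s \<le> 1 * (t - s)"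
    and N1: "\<And>s t. \<lbrakk>0 \<le> s; s \<le> t; t \<le> 1\<rbrakk> \<Longrightarrow> N s \<le> N t \<and> N t - N s \<le> 1 * (t - s)"
    and P_const: "\<And>s t. \<lbrakk>0 \<le> s; s \<le> t; t \<le> 1;
       \<And>u d. \<lbrakk>s < u; u < t; (delta_hat \<delta> has_real_derivative d) (at u)\<rbrakk> \<Longrightarrow> d \<le> 0\<rbrakk> \<Longrightarrow> P t = P s"
    and N_const: "\<And>s t. \<lbrakk>0 \<le> s; s \<le> t; t \<le> 1;
       \<And>u d. \<lbrakk>s < u; u < t; (delta_hat \<delta> has_real_derivative d) (at u)\<rbrakk> \<Longrightarrow> 0 \<le> d\<rbrakk> \<Longrightarrow> N t = N s"
  have dec: "\<And>t. t \<in> {0..1} \<Longrightarrow> delta_hat \<delta> t = P t - N t"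
    and P: "\<And>s t. \<lbrakk>0 \<le> s; s \<le> t; t \<le> 1\<rbrakk> \<Longrightarrow> P s \<le> P t \<and> P t - P s \<le> t - s"
    and N: "\<And>s t. \<lbrakk>0 \<le> s; s \<le> t; t \<le> 1\<rbrakk> \<Longrightarrow> N s \<le> N t \<and> N t - N s \<le> t - s"
    using dec0 P1 N1 delta_hat_0[OF assms] by simp_all
  define K where "K s t = min (s - N s) (t - P t) + min (N s) (P t)" for s t
  have K: "copula K" "has_diagonal K \<delta>"
    and K_above: "\<And>x y. \<lbrakk>0 \<le> x; x \<le> y; y \<le> 1\<rbrakk> \<Longrightarrow> K x y = min x (y - (P y - N x))"
    using copula_of_variations[OF assms zero dec P N] has_diagonal_of_variations[OF assms zero dec P N]
      copula_of_variations_above[OF assms zero dec P N]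
    by (simp_all add: K_def[abs_def])
  show ?thesis
  proof
    assume ?eq
    then show ?gap
      using C_upper_eq_A_delta_imp_gap[OF assms K] by blast
  next
    assume ?gap
    \<comment> \<open>The condition speaks of derivatives within \<open>[0, 1]\<close>, the
      variations of two-sided ones; a two-sided derivative is also one within.\<close>
    have V: "delta_hat \<delta> t \<le> t - s" if "s \<in> {0..1}" "t \<in> {0..1}" "s < t"
      "(delta_hat \<delta> has_real_derivative ds) (at s)" "(delta_hat \<delta> has_real_derivative dt) (at t)"
      "ds < 0" "0 < dt" for s t ds dt
    proof -
      have "max (delta_hat \<delta> s) (delta_hat \<delta> t) \<le> t - s"
        using \<open>?gap\<close> that(1-3,6,7) that(4,5)[THEN has_field_derivative_at_within] by blast
      then show ?thesis
        by simp
    qed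
    \<comment> \<open>One copula dominates all quasi-copulas above the diagonal: either the bound at
      the point \<open>u\<close> applies, or \<open>y - (P y - N x)\<close> is at least
      \<open>x\<close>.\<close>
    have le_K: "Q x y \<le> K x y"
      if Q: "quasi_copula Q" "has_diagonal Q \<delta>" and xy: "0 \<le> x" "x \<le> y" "y \<le> 1" for Q x y
    proof -
      have "Q x y \<le> x"
        using quasi_copula_le(1)[OF Q, of x x y] xy by simp
      moreover have "(\<exists>u\<in>{x..y}. P y - N x = delta_hat \<delta> u) \<or> P y - N x \<le> y - x"
        using xy dec P N P_const N_const V by (rule variation_alternative)
      then have "Q x y \<le> y - (P y - N x)"
        using \<open>Q x y \<le> x\<close> quasi_copula_le(2)[OF Q xy(1) _ _ xy(3)] by force
      ultimately show ?thesis
        using K_above[OF xy] by simp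
    qed
    show ?eq
    proof (intro ballI antisym)
      fix x y :: real assume xy: "x \<in> {0..1}" "y \<in> {0..1}"
      show "C_upper \<delta> x y \<le> A_delta \<delta> x y"
        using xy by (intro C_upper_le[OF K] le_A_delta copula_imp_quasi_copula) auto
      show "A_delta \<delta> x y \<le> C_upper \<delta> x y"
      proof (rule A_delta_le[OF assms])
        fix Q assume Q: "quasi_copula Q" "has_diagonal Q \<delta>"
        show "Q x y \<le> C_upper \<delta> x y"
        proof (cases "x \<le> y")
          case True
          then have "Q x y \<le> K x y"
            using le_K[OF Q] xy by simp
          also have "\<dots> \<le> C_upper \<delta> x y"
            using le_C_upper[OF K xy] .
          finally show ?thesis .
        next
          case False
          \<comment> \<open>Below the diagonal the transpose of \<open>K\<close> serves as the
            dominating copula.\<close>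
          have "has_diagonal (\<lambda>x y. Q y x) \<delta>" "has_diagonal (\<lambda>x y. K y x) \<delta>"
            using Q(2) K(2) by (auto simp: has_diagonal_def)
          then have "Q x y \<le> K y x" "K y x \<le> C_upper \<delta> x y"
            using le_K[OF quasi_copula_transpose[OF Q(1)], of y x] False xy
              le_C_upper[OF copula_transpose[OF K(1)] _ xy] by auto
          then show ?thesis
            by simp
        qed
      qed
    qed
  qed
qed

end
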